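(* Let $0<\alpha<1$, $\gamma\ge0$ with $0<\alpha+\gamma\le1$. Let $(X_t,\ t\ge0)$ be the Jacobi process, i.e. the diffusion on $(-1,1)$ with infinitesimal mean and variance $$\mu(x)=-\theta\left(x-\frac{b-a}{a+b+2}\right),\qquad\sigma^2(x)=\frac{2\theta}{a+b+2}\left(1-x^2\right),$$ where $\theta>0$, $a>0$, $b>0$. Let $\boldsymbol{m}(x)=\frac{(1-x)^a(1+x)^b}{B(a+1,b+1)2^{a+b+1}}$, $x\in(-1,1)$, with $B(\cdot,\cdot)$ the beta function, and let $(Q_n)_{n\ge0}$ be the orthonormal (Jacobi) polynomials with respect to $\boldsymbol{m}$. Let $(X^{(\alpha,\gamma)}_t,\ t\ge0)$ be the stretched non-local Jacobi process with initial density $f$ (the density of $X^{(\alpha,\gamma)}_0$) such that $f/\boldsymbol{m}\in L_2(\boldsymbol{m}(x)dx)$ and $\sum_na_nQ_n$, with $a_n=\int_{-1}^1f(y)Q_n(y)\,dy$, converges to $f/\boldsymbol{m}$ uniformly on finite intervals contained in $(-1,1)$. Then the density $p_{\alpha,\gamma}(t,x)$ of $X^{(\alpha,\gamma)}_t$ satisfies $$p_{\alpha,\gamma}(t,x)\to\frac{(1-x)^a(1+x)^b}{B(a+1,b+1)2^{a+b+1}},\qquad\text{as }t\to\infty .$$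
   Context: The convergence is pointwise in $x\in(-1,1)$. The generator of $X$ is $\mu(x)\frac{d}{dx}+\frac{\sigma^2(x)}{2}\frac{d^2}{dx^2}$; $Q_n$ has degree $n$ and is its eigenfunction with eigenvalue $-\lambda_n$, $\lambda_n=\theta n(n+a+b+1)/(a+b+2)$; the Jacobi process is the Markov process with transition density $\boldsymbol{m}(x)\sum_{n\ge0}e^{-\lambda_nt}Q_n(x)Q_n(y)$. The stretched non-local process is $X^{(\alpha,\gamma)}_t:=X_{t^{\alpha+\gamma}Z}$, where $Z=\int_0^\infty(1-\sigma^\alpha_s)_+^\gamma\,ds$ is independent of $(X_t)$ and $(\sigma^\alpha_s,s\ge0)$ is the $\alpha$-stable subordinator with $\mathbb{E}e^{-\lambda\sigma^\alpha_s}=e^{-s\lambda^\alpha}$ (with $(u)_+^\gamma=u^\gamma$ for $u>0$, $0$ for $u\le 0$). The density of $X^{(\alpha,\gamma)}_t$, $t>0$, is taken to be $p_{\alpha,\gamma}(t,x)=\int\boldsymbol{p}_{\alpha,\gamma}(x,t;y)f(y)\,dy$, where $$\boldsymbol{p}_{\alpha,\gamma}(x,t;y)=\boldsymbol{m}(x)\sum_{n=0}^\infty\operatorname{E}_{\alpha,1+\gamma/\alpha,\gamma/\alpha}(-\lambda_nt^{\alpha+\gamma})Q_n(x)Q_n(y)$$ is the transition density of $X^{(\alpha,\gamma)}$; here the Kilbas-Saigo function is $\operatorname{E}_{a,m,l}(z)=\sum_{n\ge0}c_nz^n$, $c_0=1$, $c_n=\prod_{k=0}^{n-1}\frac{\Gamma[1+a(km+l)]}{\Gamma[1+a(km+l+1)]}$.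 *)

theory Defs
  imports "HOL-Probability.Probability"
begin

text \<open>
  Parameters are passed in the order \<open>\<theta> a b\<close> (Jacobi process) and \<open>\<alpha> \<gamma>\<close> (time change).
  All integrals over the state space are Lebesgue integrals over the open interval \<open>(-1,1)\<close>.
\<close>

definition jacobi_drift :: "real \<Rightarrow> real \<Rightarrow> real \<Rightarrow> real \<Rightarrow> real" where
  "jacobi_drift \<theta> a b x = - \<theta> * (x - (b - a) / (a + b + 2))"

definition jacobi_variance :: "real \<Rightarrow> real \<Rightarrow> real \<Rightarrow> real \<Rightarrow> real" where
  "jacobi_variance \<theta> a b x = 2 * \<theta> / (a + b + 2) * (1 - x\<^sup>2)"

definition jacobi_weight :: "real \<Rightarrow> real \<Rightarrow> real \<Rightarrow> real" where
  "jacobi_weight a b x =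
     (1 - x) powr a * (1 + x) powr b / (Beta (a + 1) (b + 1) * 2 powr (a + b + 1))"

definition jacobi_eigenvalue :: "real \<Rightarrow> real \<Rightarrow> real \<Rightarrow> nat \<Rightarrow> real" where
  "jacobi_eigenvalue \<theta> a b n = \<theta> * real n * (real n + a + b + 1) / (a + b + 2)"

text \<open>
  This determines each \<open>Q n\<close> up to its sign, which is immaterial below: \<open>Q n\<close> only enters
  through products of two of its values.
\<close>

definition orthonormal_polys :: "real set \<Rightarrow> (real \<Rightarrow> real) \<Rightarrow> (nat \<Rightarrow> real poly) \<Rightarrow> bool" where
  "orthonormal_polys D w Q \<longleftrightarrow>
     (\<forall>n. degree (Q n) = n) \<and>
     (\<forall>i j. set_integrable lborel D (\<lambda>x. poly (Q i) x * poly (Q j) x * w x) \<and>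
            (LINT x:D|lborel. poly (Q i) x * poly (Q j) x * w x) = (if i = j then 1 else 0))"

text \<open>The sigma-algebra on \<open>space M\<close> generated by \<open>X u\<close>, \<open>u \<in> I\<close>.\<close>

definition process_sigma :: "'w measure \<Rightarrow> (real \<Rightarrow> 'w \<Rightarrow> real) \<Rightarrow> real set \<Rightarrow> 'w measure" where
  "process_sigma M X I =
     vimage_algebra (space M) (\<lambda>\<omega>. \<lambda>u\<in>I. X u \<omega>) (\<Pi>\<^sub>M u\<in>I. (borel :: real measure))"

text \<open>
  A transition density \<open>q x t y\<close> is the density in the end point \<open>x\<close> at time \<open>t\<close>
  of the process started from \<open>y\<close>.
\<close>

definition markov_process_with_density ::
    "'w measure \<Rightarrow> real set \<Rightarrow> (real \<Rightarrow> real \<Rightarrow> real \<Rightarrow> real) \<Rightarrow> (real \<Rightarrow> 'w \<Rightarrow> real) \<Rightarrow> bool" where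
  "markov_process_with_density M D q X \<longleftrightarrow>
     (\<forall>t\<ge>0. X t \<in> borel_measurable M) \<and>
     (\<forall>t\<ge>0. \<forall>\<omega>\<in>space M. X t \<omega> \<in> D) \<and>
     (\<forall>s\<ge>0. \<forall>t>0. \<forall>B\<in>sets borel. AE \<omega> in M.
        real_cond_exp M (process_sigma M X {0..s}) (indicat_real (X (s + t) -` B \<inter> space M)) \<omega>
          = (LINT x:B \<inter> D|lborel. q x t (X s \<omega>)))"

definition infinitesimal_mean ::
    "real set \<Rightarrow> (real \<Rightarrow> real \<Rightarrow> real \<Rightarrow> real) \<Rightarrow> (real \<Rightarrow> real) \<Rightarrow> bool" where
  "infinitesimal_mean D q \<mu> \<longleftrightarrow>
     (\<forall>y\<in>D. ((\<lambda>h. (LINT x:D|lborel. (x - y) * q x h y) / h) \<longlongrightarrow> \<mu> y) (at_right 0))"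

definition infinitesimal_variance ::
    "real set \<Rightarrow> (real \<Rightarrow> real \<Rightarrow> real \<Rightarrow> real) \<Rightarrow> (real \<Rightarrow> real) \<Rightarrow> bool" where
  "infinitesimal_variance D q v \<longleftrightarrow>
     (\<forall>y\<in>D. ((\<lambda>h. (LINT x:D|lborel. (x - y)\<^sup>2 * q x h y) / h) \<longlongrightarrow> v y) (at_right 0))"

definition diffusion ::
    "'w measure \<Rightarrow> real set \<Rightarrow> (real \<Rightarrow> real \<Rightarrow> real \<Rightarrow> real) \<Rightarrow> (real \<Rightarrow> real) \<Rightarrow> (real \<Rightarrow> real)
     \<Rightarrow> (real \<Rightarrow> 'w \<Rightarrow> real) \<Rightarrow> bool" where
  "diffusion M D q \<mu> v X \<longleftrightarrow>
     markov_process_with_density M D q X \<and>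
     (\<forall>\<omega>\<in>space M. continuous_on {0..} (\<lambda>t. X t \<omega>)) \<and>
     infinitesimal_mean D q \<mu> \<and> infinitesimal_variance D q v"

definition jacobi_transition_density ::
    "real \<Rightarrow> real \<Rightarrow> real \<Rightarrow> (nat \<Rightarrow> real poly) \<Rightarrow> real \<Rightarrow> real \<Rightarrow> real \<Rightarrow> real" where
  "jacobi_transition_density \<theta> a b Q x t y =
     jacobi_weight a b x *
     (\<Sum>n. exp (- jacobi_eigenvalue \<theta> a b n * t) * poly (Q n) x * poly (Q n) y)"

definition jacobi_process ::
    "'w measure \<Rightarrow> real \<Rightarrow> real \<Rightarrow> real \<Rightarrow> (nat \<Rightarrow> real poly) \<Rightarrow> (real \<Rightarrow> 'w \<Rightarrow> real) \<Rightarrow> bool" where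
  "jacobi_process M \<theta> a b Q X \<longleftrightarrow>
     diffusion M {-1<..<1} (jacobi_transition_density \<theta> a b Q)
       (jacobi_drift \<theta> a b) (jacobi_variance \<theta> a b) X"

definition stable_subordinator :: "'w measure \<Rightarrow> real \<Rightarrow> (real \<Rightarrow> 'w \<Rightarrow> real) \<Rightarrow> bool" where
  "stable_subordinator M \<alpha> S \<longleftrightarrow>
     (\<forall>s\<ge>0. S s \<in> borel_measurable M) \<and>
     (\<forall>\<omega>\<in>space M. S 0 \<omega> = 0 \<and> mono_on {0..} (\<lambda>s. S s \<omega>) \<and>
        (\<forall>s\<ge>0. continuous (at_right s) (\<lambda>u. S u \<omega>))) \<and>
     (\<forall>(n::nat) r. 0 \<le> r 0 \<and> mono r \<longrightarrow>
        prob_space.indep_vars M (\<lambda>_. borel) (\<lambda>i \<omega>. S (r (Suc i)) \<omega> - S (r i) \<omega>) {..<n}) \<and>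
     (\<forall>s\<ge>0. \<forall>h\<ge>0. distr M borel (\<lambda>\<omega>. S (s + h) \<omega> - S s \<omega>) = distr M borel (S h)) \<and>
     (\<forall>s\<ge>0. \<forall>l\<ge>0. (LINT \<omega>|M. exp (- l * S s \<omega>)) = exp (- s * l powr \<alpha>))"

text \<open>
  The case distinction is needed for \<open>\<gamma> = 0\<close>, where the power is the indicator of \<open>u > 0\<close>.
\<close>

definition pos_part_powr :: "real \<Rightarrow> real \<Rightarrow> real" where
  "pos_part_powr u \<gamma> = (if u > 0 then u powr \<gamma> else 0)"

definition time_change_variable :: "real \<Rightarrow> (real \<Rightarrow> 'w \<Rightarrow> real) \<Rightarrow> 'w \<Rightarrow> real" where
  "time_change_variable \<gamma> S \<omega> = (LINT s:{0..}|lborel. pos_part_powr (1 - S s \<omega>) \<gamma>)"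

definition stretched_process ::
    "real \<Rightarrow> real \<Rightarrow> (real \<Rightarrow> 'w \<Rightarrow> real) \<Rightarrow> (real \<Rightarrow> 'w \<Rightarrow> real) \<Rightarrow> real \<Rightarrow> 'w \<Rightarrow> real" where
  "stretched_process \<alpha> \<gamma> S X t \<omega> = X (t powr (\<alpha> + \<gamma>) * time_change_variable \<gamma> S \<omega>) \<omega>"

text \<open>
  \<open>S\<close> is the \<open>\<alpha>\<close>-stable subordinator defining the random time; only the time variable (not \<open>S\<close>
  itself) is required to be independent of the Jacobi process \<open>X\<close>.
\<close>

definition stretched_jacobi_setting ::
    "'w measure \<Rightarrow> real \<Rightarrow> real \<Rightarrow> real \<Rightarrow> real \<Rightarrow> real \<Rightarrow> (nat \<Rightarrow> real poly)
     \<Rightarrow> (real \<Rightarrow> 'w \<Rightarrow> real) \<Rightarrow> (real \<Rightarrow> 'w \<Rightarrow> real) \<Rightarrow> bool" where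
  "stretched_jacobi_setting M \<alpha> \<gamma> \<theta> a b Q S X \<longleftrightarrow>
     prob_space M \<and> jacobi_process M \<theta> a b Q X \<and> stable_subordinator M \<alpha> S \<and>
     prob_space.indep_set M
       (sets (vimage_algebra (space M) (time_change_variable \<gamma> S) borel))
       (sets (process_sigma M X {0..}))"

definition kilbas_saigo :: "real \<Rightarrow> real \<Rightarrow> real \<Rightarrow> real \<Rightarrow> real" where
  "kilbas_saigo a m l z =
     (\<Sum>n. (\<Prod>k<n. Gamma (1 + a * (real k * m + l)) / Gamma (1 + a * (real k * m + l + 1))) * z ^ n)"

definition stretched_transition_density ::
    "real \<Rightarrow> real \<Rightarrow> real \<Rightarrow> real \<Rightarrow> real \<Rightarrow> (nat \<Rightarrow> real poly) \<Rightarrow> real \<Rightarrow> real \<Rightarrow> real \<Rightarrow> real" where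
  "stretched_transition_density \<alpha> \<gamma> \<theta> a b Q x t y =
     jacobi_weight a b x *
     (\<Sum>n. kilbas_saigo \<alpha> (1 + \<gamma> / \<alpha>) (\<gamma> / \<alpha>) (- jacobi_eigenvalue \<theta> a b n * t powr (\<alpha> + \<gamma>)) *
           poly (Q n) x * poly (Q n) y)"

text \<open>
  A density is only determined almost everywhere, so a pointwise limit is about a chosen version
  of it: the density of \<open>stretched_process \<alpha> \<gamma> S X t\<close>, \<open>t > 0\<close>, for initial density \<open>f\<close> is taken
  to be the following function of \<open>x\<close>.
\<close>

definition stretched_density ::
    "real \<Rightarrow> real \<Rightarrow> real \<Rightarrow> real \<Rightarrow> real \<Rightarrow> (nat \<Rightarrow> real poly) \<Rightarrow> (real \<Rightarrow> real)
     \<Rightarrow> real \<Rightarrow> real \<Rightarrow> real" where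
  "stretched_density \<alpha> \<gamma> \<theta> a b Q f t x =
     (LINT y:{-1<..<1}|lborel. stretched_transition_density \<alpha> \<gamma> \<theta> a b Q x t y * f y)"

text \<open>
  The values of \<open>f\<close> outside \<open>D\<close> are irrelevant: they are cut off by the indicator.
\<close>

definition has_density_on ::
    "'w measure \<Rightarrow> ('w \<Rightarrow> real) \<Rightarrow> real set \<Rightarrow> (real \<Rightarrow> real) \<Rightarrow> bool" where
  "has_density_on M Y D f \<longleftrightarrow>
     (\<forall>x\<in>D. f x \<ge> 0) \<and> distributed M lborel Y (\<lambda>x. ennreal (indicat_real D x * f x))"

definition fourier_coeff :: "(nat \<Rightarrow> real poly) \<Rightarrow> (real \<Rightarrow> real) \<Rightarrow> nat \<Rightarrow> real" where
  "fourier_coeff Q f n = (LINT y:{-1<..<1}|lborel. f y * poly (Q n) y)"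

end

theory Submission
  imports Defs "HOL-Real_Asymp.Real_Asymp"
begin

text \<open>
  Put \<open>F(z) = E(-z)\<close> for the Kilbas--Saigo function \<open>E\<close> with parameters \<open>\<alpha>, 1 + \<gamma>/\<alpha>, \<gamma>/\<alpha>\<close>. Comparing
  coefficients, \<open>F\<close> satisfies
  \<open>(1 + \<Gamma>(1-\<alpha>) z) F(z) = 1 + \<alpha> \<integral> (F(z r^(\<alpha>+\<gamma>)) - F(z)) (1-r)^(-\<alpha>-1) dr\<close> over \<open>0 < r < 1\<close>, which is
  the fractional equation of \<open>t \<mapsto> F(t^(\<alpha>+\<gamma>))\<close> in Marchaud form. Looking at the first point of
  contact with \<open>0\<close>, respectively with a multiple of \<open>1 / (1 + c z)\<close>, gives \<open>0 < F(z) = O(1/z)\<close>.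

  The orthonormal polynomials satisfy \<open>Q\<^sub>n(x)\<^sup>2 = O(n)\<close> at interior points, and the eigenvalues grow
  like \<open>n\<^sup>2\<close>; so the coefficients \<open>F(\<lambda>\<^sub>n T) Q\<^sub>n(x)\<close>, \<open>n \<ge> 1\<close>, are absolutely summable with sum
  \<open>O(1/T)\<close>. Since the integrals of \<open>\<bar>Q\<^sub>n f\<bar>\<close> are bounded, series and integral may be
  exchanged, and only the term \<open>n = 0\<close>, which is the Jacobi weight, survives as \<open>T \<rightarrow> \<infinity>\<close>.
\<close>

section \<open>Decay of the Kilbas--Saigo function\<close>

lemma has_bochner_integral_lborel_has_integral:
  fixes f :: "real \<Rightarrow> real"
  assumes "(f has_integral I) A" and nonneg: "\<And>x. x \<in> A \<Longrightarrow> 0 \<le> f x"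
    and "set_borel_measurable borel A f"
  shows "has_bochner_integral lborel (\<lambda>x. indicator A x * f x) I"
proof (rule has_bochner_integral_nn_integral)
  show "(\<lambda>x. indicator A x * f x) \<in> borel_measurable lborel"
    using assms(3) by (simp add: set_borel_measurable_def)
  show "AE x in lborel. 0 \<le> indicator A x * f x"
    using nonneg by (auto simp: indicator_def)
  show "0 \<le> I" using assms(1) nonneg by (rule has_integral_nonneg)
  show "(\<integral>\<^sup>+x. ennreal (indicator A x * f x) \<partial>lborel) = ennreal I"
    by (rule nn_integral_has_integral_lebesgue[OF nonneg assms(1)])
qed

text \<open>Integration by parts. The boundary function \<open>H\<close> is 1 at 0 and 0 at 1, and
  its derivative is the integrand minus \<open>p\<close> times a Beta integrand; so the integral
  equals \<open>p * Beta p (1 - \<alpha>) - 1\<close>.\<close>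

lemma marchaud_power_integral:
  fixes \<alpha> p :: real
  assumes "0 < \<alpha>" "\<alpha> < 1" "0 < p"
  shows "has_bochner_integral lborel
    (\<lambda>r. indicator {0<..<1} r * ((1 - r powr p) * (\<alpha> * (1 - r) powr (- \<alpha> - 1))))
    (Gamma (1 - \<alpha>) * Gamma (1 + p) / Gamma (1 + p - \<alpha>) - 1)"
proof (rule has_bochner_integral_lborel_has_integral)
  define H where "H r = (1 - r powr p) * (1 - r) powr (- \<alpha>)" for r :: real
  define H' where "H' r = (1 - r powr p) * (\<alpha> * (1 - r) powr (- \<alpha> - 1))
      - p * (r powr (p - 1) * (1 - r) powr (1 - \<alpha> - 1))" for r :: real
  have "continuous (at r within {0..1}) H" if "r \<in> {0..1}" for r
  proof (cases "r = 1")
    case True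
    \<comment> \<open>The factor \<open>1 - r powr p\<close> vanishes to first order at 1 and beats
      the singularity of order \<alpha> < 1.\<close>
    have "(H \<longlongrightarrow> 0) (at_left 1)"
      unfolding H_def using assms by real_asymp
    then show ?thesis
      using True by (auto simp: continuous_within H_def at_within_Icc_at_left)
  next
    case False
    have "continuous_on {0..1} (\<lambda>r::real. 1 - r powr p)"
      using assms by (intro continuous_intros continuous_on_powr') auto
    then have "((\<lambda>r. 1 - r powr p) \<longlongrightarrow> 1 - r powr p) (at r within {0..1})"
      using that by (auto simp: continuous_on_def)
    moreover have "((\<lambda>r. (1 - r) powr (- \<alpha>)) \<longlongrightarrow> (1 - r) powr (- \<alpha>)) (at r within {0..1})"
      using False by (intro tendsto_intros) auto
    ultimately show ?thesis
      unfolding H_def continuous_within by (rule tendsto_mult)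
  qed
  then have contH: "continuous_on {0..1} H"
    by (auto simp: continuous_on_eq_continuous_within)
  have "(H' has_integral H 1 - H 0) {0..1}"
  proof (rule fundamental_theorem_of_calculus_interior[OF _ contH])
    fix r :: real assume r: "r \<in> {0<..<1}"
    have "(H has_real_derivative H' r) (at r)"
      unfolding H_def H'_def using r
      by (auto intro!: derivative_eq_intros simp: algebra_simps)
    then show "(H has_vector_derivative H' r) (at r)"
      by (simp add: has_real_derivative_iff_has_vector_derivative)
  qed simp
  then have "((\<lambda>r. H' r + p * (r powr (p - 1) * (1 - r) powr (1 - \<alpha> - 1)))
      has_integral (H 1 - H 0) + p * Beta p (1 - \<alpha>)) {0..1}"
    using assms by (intro has_integral_add has_integral_mult_right has_integral_Beta_real) auto
  moreover have "H 1 - H 0 + p * Beta p (1 - \<alpha>) =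
      Gamma (1 - \<alpha>) * Gamma (1 + p) / Gamma (1 + p - \<alpha>) - 1"
  proof -
    have "p \<notin> \<int>\<^sub>\<le>\<^sub>0" using assms by (auto dest: nonpos_Ints_nonpos)
    then show ?thesis
      using Gamma_plus1[of p] by (simp add: H_def Beta_def add_ac add_diff_eq)
  qed
  ultimately show "((\<lambda>r. (1 - r powr p) * (\<alpha> * (1 - r) powr (- \<alpha> - 1))) has_integral
      (Gamma (1 - \<alpha>) * Gamma (1 + p) / Gamma (1 + p - \<alpha>) - 1)) {0<..<1}"
    by (simp add: H'_def has_integral_Icc_iff_Ioo)
  show "0 \<le> (1 - r powr p) * (\<alpha> * (1 - r) powr (- \<alpha> - 1))" if "r \<in> {0<..<1}" for r
    using that assms by (auto intro!: mult_nonneg_nonneg powr_le1)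
  show "set_borel_measurable borel {0<..<1} (\<lambda>r. (1 - r powr p) * (\<alpha> * (1 - r) powr (- \<alpha> - 1)))"
    unfolding set_borel_measurable_def by measurable
qed

text \<open>Log-convexity of Gamma, applied to x + 1 as the convex combination of x + \<alpha> and x
  + \<alpha> + 1 with weights \<alpha> and 1 - \<alpha>; the functional equation then removes the
  shifts by 1. The bound is of order x^(-\<alpha>) and feeds the ratio test for the Kilbas-Saigo
  series.\<close>

lemma Gamma_ratio_le:
  fixes x \<alpha> :: real
  assumes "0 < \<alpha>" "\<alpha> < 1" "0 < x"
  shows "Gamma x / Gamma (x + \<alpha>) \<le> (x + \<alpha>) powr (1 - \<alpha>) / x"
proof -
  have "convex_on {0<..} (ln \<circ> Gamma :: real \<Rightarrow> real)"
    by (rule log_convex_Gamma_real)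
  then have "(ln \<circ> Gamma) ((1 - (1 - \<alpha>)) *\<^sub>R (x + \<alpha>) + (1 - \<alpha>) *\<^sub>R (x + \<alpha> + 1))
      \<le> (1 - (1 - \<alpha>)) * (ln \<circ> Gamma) (x + \<alpha>) + (1 - \<alpha>) * (ln \<circ> Gamma) (x + \<alpha> + 1)"
    using assms by (intro convex_onD[OF \<open>convex_on {0<..} (ln \<circ> Gamma)\<close>]) auto
  also have "(1 - (1 - \<alpha>)) *\<^sub>R (x + \<alpha>) + (1 - \<alpha>) *\<^sub>R (x + \<alpha> + 1) = x + 1"
    by (simp add: algebra_simps)
  finally have "ln (Gamma (x + 1)) \<le> \<alpha> * ln (Gamma (x + \<alpha>)) + (1 - \<alpha>) * ln (Gamma (x + \<alpha> + 1))"
    by simp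
  also have "Gamma (x + \<alpha> + 1) = (x + \<alpha>) * Gamma (x + \<alpha>)"
    using assms by (intro Gamma_plus1) (auto dest: nonpos_Ints_nonpos)
  also have "ln \<dots> = ln (x + \<alpha>) + ln (Gamma (x + \<alpha>))"
  proof -
    have "x + \<alpha> \<noteq> 0" "Gamma (x + \<alpha>) \<noteq> 0"
      using assms Gamma_real_pos[of "x + \<alpha>"] by fastforce+
    then show ?thesis by (simp only: ln_mult) simp
  qed
  also have "Gamma (x + 1) = x * Gamma x"
    using assms by (intro Gamma_plus1) (auto dest: nonpos_Ints_nonpos)
  finally have "ln (x * Gamma x) \<le> ln (Gamma (x + \<alpha>)) + (1 - \<alpha>) * ln (x + \<alpha>)"
    by (simp add: algebra_simps)
  also have "\<dots> = ln (Gamma (x + \<alpha>) * (x + \<alpha>) powr (1 - \<alpha>))"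
  proof -
    have "Gamma (x + \<alpha>) \<noteq> 0" "(x + \<alpha>) powr (1 - \<alpha>) \<noteq> 0"
      using assms Gamma_real_pos[of "x + \<alpha>"] by fastforce+
    then show ?thesis by (simp only: ln_mult ln_powr) simp
  qed
  finally have "x * Gamma x \<le> Gamma (x + \<alpha>) * (x + \<alpha>) powr (1 - \<alpha>)"
    using assms Gamma_real_pos[of "x + \<alpha>"] Gamma_real_pos[of x] by (subst (asm) ln_le_cancel_iff) auto
  then show ?thesis
    using assms Gamma_real_pos[of "x + \<alpha>"] by (simp add: field_simps)
qed

lemma has_bochner_integral_mono:
  fixes f g :: "'a \<Rightarrow> real"
  assumes "has_bochner_integral M f I" "has_bochner_integral M g J" "\<And>x. f x \<le> g x"
  shows "I \<le> J"
  using assms integral_mono[of M f g] by (auto simp: has_bochner_integral_iff)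

section \<open>The Kilbas-Saigo series and its Marchaud identity\<close>

locale kilbas_saigo_exponents =
  fixes \<alpha> \<gamma> :: real
  assumes \<alpha>: "0 < \<alpha>" "\<alpha> < 1" and \<gamma>: "0 \<le> \<gamma>"
begin

definition coef :: "nat \<Rightarrow> real" where
  "coef n = (\<Prod>k<n. Gamma (1 + \<gamma> + real k * (\<alpha> + \<gamma>)) / Gamma (1 + \<gamma> + real k * (\<alpha> + \<gamma>) + \<alpha>))"

definition E :: "real \<Rightarrow> real" where
  "E z = (\<Sum>n. coef n * z ^ n)"

lemma kilbas_saigo_eq: "kilbas_saigo \<alpha> (1 + \<gamma> / \<alpha>) (\<gamma> / \<alpha>) z = E z"
proof -
  have "1 + \<alpha> * (real k * (1 + \<gamma> / \<alpha>) + \<gamma> / \<alpha>) = 1 + \<gamma> + real k * (\<alpha> + \<gamma>)"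
    and "1 + \<alpha> * (real k * (1 + \<gamma> / \<alpha>) + \<gamma> / \<alpha> + 1) = 1 + \<gamma> + real k * (\<alpha> + \<gamma>) + \<alpha>" for k
    using \<alpha> by (simp_all add: field_simps)
  then show ?thesis
    by (simp only: kilbas_saigo_def E_def coef_def)
qed

lemma arg_pos: "0 < 1 + \<gamma> + real k * (\<alpha> + \<gamma>)"
  using \<alpha> \<gamma> by (simp add: add_pos_nonneg)

lemma coef_pos: "0 < coef n"
  unfolding coef_def using arg_pos \<alpha>
  by (intro prod_pos ballI divide_pos_pos Gamma_real_pos add_pos_pos[OF arg_pos])

lemma coef_0 [simp]: "coef 0 = 1"
  by (simp add: coef_def)

lemma coef_Suc:
  "coef (Suc n) = coef n * (Gamma (1 + \<gamma> + real n * (\<alpha> + \<gamma>)) / Gamma (1 + \<gamma> + real n * (\<alpha> + \<gamma>) + \<alpha>))"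
  by (simp add: coef_def)

text \<open>With p = (\<alpha> + \<gamma>)(n + 1), the Gamma quotient of
  \<open>marchaud_power_integral\<close> cancels exactly the last factor of
  \<open>coef (Suc n)\<close>. This is the coefficient comparison behind
  \<open>marchaud_identity\<close>.\<close>

lemma coef_Suc_marchaud:
  "coef (Suc n) * (Gamma (1 - \<alpha>) * Gamma (1 + (\<alpha> + \<gamma>) * real (Suc n))
     / Gamma (1 + (\<alpha> + \<gamma>) * real (Suc n) - \<alpha>)) = Gamma (1 - \<alpha>) * coef n"
proof -
  have *: "1 + (\<alpha> + \<gamma>) * real (Suc n) = 1 + \<gamma> + real n * (\<alpha> + \<gamma>) + \<alpha>"
    by (simp add: algebra_simps)
  have "Gamma (1 + \<gamma> + real n * (\<alpha> + \<gamma>)) > 0" "Gamma (1 + \<gamma> + real n * (\<alpha> + \<gamma>) + \<alpha>) > 0"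
    using arg_pos[of n] \<alpha> by (auto intro!: Gamma_real_pos)
  then show ?thesis
    unfolding coef_Suc * by (simp add: field_simps)
qed

text \<open>Ratio test: by \<open>Gamma_ratio_le\<close> the quotient of consecutive coefficients is
  of order n^(-\<alpha>), so the series is entire.\<close>

lemma summable_coef: "summable (\<lambda>n. norm (coef n * z ^ n))"
proof (cases "z = 0")
  case True
  then show ?thesis by (intro summable_finite[of "{0}"]) auto
next
  case False
  define \<delta> where "\<delta> = \<alpha> + \<gamma>"
  have \<delta>: "\<delta> > 0" using \<alpha> \<gamma> by (simp add: \<delta>_def)
  let ?B = "\<lambda>n. (1 + \<gamma> + real n * \<delta> + \<alpha>) powr (1 - \<alpha>) / (1 + \<gamma> + real n * \<delta>)"
  have "(\<lambda>n. ?B n * \<bar>z\<bar>) \<longlonglongrightarrow> 0"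
    using \<alpha> \<gamma> \<delta> by real_asymp
  then have "eventually (\<lambda>n. ?B n * \<bar>z\<bar> < 1 / 2) sequentially"
    by (rule order_tendstoD) simp
  then obtain N where N: "\<And>n. n \<ge> N \<Longrightarrow> ?B n * \<bar>z\<bar> < 1 / 2"
    by (auto simp: eventually_sequentially)
  have "norm (norm (coef (Suc n) * z ^ Suc n)) \<le> 1 / 2 * norm (norm (coef n * z ^ n))" if "n \<ge> N" for n
  proof -
    have "Gamma (1 + \<gamma> + real n * \<delta>) / Gamma (1 + \<gamma> + real n * \<delta> + \<alpha>) * \<bar>z\<bar> \<le> ?B n * \<bar>z\<bar>"
      using Gamma_ratio_le[of \<alpha> "1 + \<gamma> + real n * \<delta>"] \<alpha> arg_pos[of n]
      by (intro mult_right_mono) (auto simp: \<delta>_def)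
    also have "\<dots> \<le> 1 / 2" using N[OF that] by simp
    finally have "coef n * \<bar>z\<bar> ^ n * (Gamma (1 + \<gamma> + real n * \<delta>) / Gamma (1 + \<gamma> + real n * \<delta> + \<alpha>) * \<bar>z\<bar>)
        \<le> coef n * \<bar>z\<bar> ^ n * (1 / 2)"
      using coef_pos[of n] by (intro mult_left_mono) auto
    moreover have norm_eq: "norm (norm (coef m * z ^ m)) = coef m * \<bar>z\<bar> ^ m" for m
      using coef_pos[of m] by (simp add: abs_mult power_abs)
    ultimately show ?thesis
      unfolding norm_eq by (simp add: coef_Suc[folded \<delta>_def] mult_ac)
  qed
  then show ?thesis
    by (intro summable_ratio_test[of "1/2" N]) auto
qed

lemma E_sums: "(\<lambda>n. coef n * z ^ n) sums E z"
  unfolding E_def by (rule summable_sums) (rule summable_norm_cancel[OF summable_coef])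

lemma continuous_on_E: "continuous_on A E"
proof -
  have "isCont (\<lambda>z. \<Sum>n. coef n * z ^ n) z" for z
    by (rule isCont_powser[of _ "\<bar>z\<bar> + 1"]) (use summable_norm_cancel[OF summable_coef] in auto)
  then show ?thesis
    unfolding E_def by (auto intro!: continuous_at_imp_continuous_on)
qed

lemma E_0 [simp]: "E 0 = 1"
  using powser_sums_zero[of coef] E_sums[of 0] by (auto simp: sums_iff)

abbreviation kernel :: "real \<Rightarrow> real" where
  "kernel r \<equiv> \<alpha> * (1 - r) powr (- \<alpha> - 1)"

text \<open>The power integrals are summed term by term against the coefficients at -z, and
  \<open>coef_Suc_marchaud\<close> evaluates the result. The terms carry 1 - r^((\<alpha> +
  \<gamma>) n), which produces the identity with the opposite sign; it is negated at the
  end.\<close>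

lemma marchaud_identity:
  assumes "0 \<le> z"
  shows "has_bochner_integral lborel
     (\<lambda>r. indicator {0<..<1} r * ((E (- (z * r powr (\<alpha> + \<gamma>))) - E (- z)) * kernel r))
     ((1 + Gamma (1 - \<alpha>) * z) * E (- z) - 1)"
proof -
  define \<delta> where "\<delta> = \<alpha> + \<gamma>"
  have \<delta>: "\<delta> > 0" using \<alpha> \<gamma> by (simp add: \<delta>_def)
  \<comment> \<open>\<open>J n\<close> is the integral of \<open>g n\<close>. The formula also gives
    0 at n = 0, but \<open>marchaud_power_integral\<close> requires a positive exponent.\<close>
  define J where "J n = (if n = 0 then 0 else
    Gamma (1 - \<alpha>) * Gamma (1 + \<delta> * real n) / Gamma (1 + \<delta> * real n - \<alpha>) - 1)" for n
  define g where "g n r = indicator {0<..<1} r * ((1 - r powr (\<delta> * real n)) * kernel r)" for n r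
  have g: "has_bochner_integral lborel (g n) (J n)" for n
  proof (cases "n = 0")
    case True
    then have "g n = (\<lambda>r. 0)" by (auto simp: g_def indicator_def)
    then show ?thesis using True by (simp add: J_def has_bochner_integral_zero)
  next
    case False
    then show ?thesis
      using marchaud_power_integral[of \<alpha> "\<delta> * real n"] \<alpha> \<delta> by (simp add: g_def[abs_def] J_def)
  qed
  have g_nonneg: "g n r \<ge> 0" and g_le: "g n r \<le> indicator {0<..<1} r * kernel r" for n r
    using \<alpha> \<delta> by (auto simp: g_def indicator_def intro!: mult_nonneg_nonneg powr_le1 mult_left_le_one_le)
  have J_nonneg: "J n \<ge> 0" for n
    using g[of n] g_nonneg[of n] by (metis Bochner_Integration.integral_nonneg has_bochner_integral_integral_eq)
  \<comment> \<open>The terms with index n + 1 are differences of a term of \<Gamma>(1-\<alpha>) w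
    E(w) and a term of E(w); the summand 1 is the constant term of E, lost in the index shift. It is
    used at w = z for absolute summability and at w = -z for the value.\<close>
  have sumsJ: "(\<lambda>n. coef n * w ^ n * J n) sums (Gamma (1 - \<alpha>) * w * E w - E w + 1)" for w
  proof -
    have "(\<lambda>n. Gamma (1 - \<alpha>) * w * (coef n * w ^ n)) sums (Gamma (1 - \<alpha>) * w * E w)"
      by (intro sums_mult E_sums)
    moreover have "(\<lambda>n. coef (Suc n) * w ^ Suc n) sums (E w - coef 0 * w ^ 0)"
      using E_sums[of w] by (subst sums_Suc_iff) simp
    ultimately have "(\<lambda>n. Gamma (1 - \<alpha>) * w * (coef n * w ^ n) - coef (Suc n) * w ^ Suc n) sums
       (Gamma (1 - \<alpha>) * w * E w - (E w - coef 0 * w ^ 0))"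
      by (rule sums_diff)
    moreover have "Gamma (1 - \<alpha>) * w * (coef n * w ^ n) - coef (Suc n) * w ^ Suc n =
        coef (Suc n) * w ^ Suc n * J (Suc n)" for n
      using arg_cong[OF coef_Suc_marchaud[of n, folded \<delta>_def], of "\<lambda>u. u * w ^ Suc n"]
      by (simp add: J_def algebra_simps)
    ultimately have "(\<lambda>n. coef (Suc n) * w ^ Suc n * J (Suc n)) sums (Gamma (1 - \<alpha>) * w * E w - E w + 1)"
      by (simp add: coef_0 algebra_simps del: power_Suc)
    then show ?thesis
      by (subst (asm) sums_Suc_iff) (simp add: J_def)
  qed
  let ?f = "\<lambda>n r. coef n * (- z) ^ n * g n r"
  have int: "integrable lborel (?f n)" for n
    using g[of n] by (intro integrable_mult_right) (simp add: has_bochner_integral_iff)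
  \<comment> \<open>This domination is only pointwise in r, since the kernel is not integrable at 1.
    The series of integrals is controlled separately, by \<open>sumsJ\<close> at z.\<close>
  have summ: "summable (\<lambda>n. norm (?f n r))" for r
  proof (rule summable_comparison_test)
    show "\<exists>N. \<forall>n\<ge>N. norm (norm (?f n r)) \<le> norm (coef n * z ^ n) * (indicator {0<..<1} r * kernel r)"
      using g_le g_nonneg coef_pos assms
      by (auto simp: abs_mult power_abs intro!: exI[of _ 0] mult_left_mono)
    show "summable (\<lambda>n. norm (coef n * z ^ n) * (indicator {0<..<1} r * kernel r))"
      by (intro summable_mult2 summable_coef)
  qed
  have "(\<integral>r. norm (?f n r) \<partial>lborel) = coef n * z ^ n * J n" for n
  proof -
    have "(\<lambda>r. norm (?f n r)) = (\<lambda>r. coef n * z ^ n * g n r)"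
      using g_nonneg coef_pos[of n] assms by (auto simp: abs_mult power_abs)
    then show ?thesis
      using g[of n] by (simp add: has_bochner_integral_iff)
  qed
  then have summ_int: "summable (\<lambda>n. \<integral>r. norm (?f n r) \<partial>lborel)"
    using sumsJ[of z] by (simp add: sums_iff)
  have "has_bochner_integral lborel (\<lambda>r. \<Sum>n. ?f n r) (\<Sum>n. \<integral>r. ?f n r \<partial>lborel)"
    using integrable_suminf[OF int _ summ_int] integral_suminf[OF int _ summ_int] summ
    by (simp add: has_bochner_integral_iff)
  also have "(\<lambda>n. \<integral>r. ?f n r \<partial>lborel) = (\<lambda>n. coef n * (- z) ^ n * J n)"
    using has_bochner_integral_integral_eq[OF has_bochner_integral_mult_right[OF g]] by blast
  also have "(\<Sum>n. coef n * (- z) ^ n * J n) = 1 - (1 + Gamma (1 - \<alpha>) * z) * E (- z)"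
    using sumsJ[of "- z"] by (simp add: sums_iff algebra_simps)
  also have "(\<lambda>r. \<Sum>n. ?f n r) =
      (\<lambda>r. - (indicator {0<..<1} r * ((E (- (z * r powr \<delta>)) - E (- z)) * kernel r)))"
  proof
    fix r :: real
    show "(\<Sum>n. ?f n r) = - (indicator {0<..<1} r * ((E (- (z * r powr \<delta>)) - E (- z)) * kernel r))"
    proof (cases "r \<in> {0<..<1}")
      case False
      then show ?thesis by (simp add: g_def)
    next
      case True
      have "(\<lambda>n. (coef n * (- z) ^ n - coef n * (- (z * r powr \<delta>)) ^ n) * kernel r) sums
          ((E (- z) - E (- (z * r powr \<delta>))) * kernel r)"
        by (intro sums_mult2 sums_diff E_sums)
      moreover have "(coef n * (- z) ^ n - coef n * (- (z * r powr \<delta>)) ^ n) * kernel r = ?f n r" for n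
      proof -
        have "(- (z * r powr \<delta>)) ^ n = (- z) ^ n * r powr (\<delta> * real n)"
        proof -
          have "(r powr \<delta>) ^ n = (r powr \<delta>) powr real n"
            using True by (intro powr_realpow[symmetric]) auto
          then have "(r powr \<delta>) ^ n = r powr (\<delta> * real n)"
            by (simp only: powr_powr)
          moreover have "(- (z * r powr \<delta>)) ^ n = (- z * r powr \<delta>) ^ n"
            by (simp only: mult_minus_left)
          ultimately show ?thesis
            by (simp only: power_mult_distrib)
        qed
        then show ?thesis
          using True by (simp add: g_def algebra_simps)
      qed
      ultimately show ?thesis
        using True by (simp add: sums_iff algebra_simps)
    qed
  qed
  finally have "has_bochner_integral lborel
      (\<lambda>r. - (indicator {0<..<1} r * ((E (- (z * r powr \<delta>)) - E (- z)) * kernel r)))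
      (1 - (1 + Gamma (1 - \<alpha>) * z) * E (- z))" .
  from has_bochner_integral_minus[OF this] show ?thesis
    by (simp only: minus_minus minus_diff_eq \<delta>_def)
qed

section \<open>Positivity and decay by comparison at the first contact point\<close>

lemma scaled_arg:
  assumes "0 < z" "r \<in> {0<..<1}"
  shows "0 \<le> z * r powr (\<alpha> + \<gamma>)" "z * r powr (\<alpha> + \<gamma>) < z"
  using assms \<alpha> \<gamma> powr_less_mono2[of "\<alpha> + \<gamma>" r 1] by auto

text \<open>At a first zero the Marchaud integral would be nonnegative, which contradicts the identity.\<close>

lemma E_pos:
  assumes "0 \<le> z"
  shows "0 < E (- z)"
proof (rule ccontr)
  assume neg: "\<not> 0 < E (- z)"
  let ?A = "{y. E (- y) \<le> 0} \<inter> {0..z}"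
  have "closed {y. E (- y) \<le> 0}"
    by (intro closed_Collect_le continuous_intros continuous_on_compose2[OF continuous_on_E]) auto
  then have "compact ?A"
    by (intro closed_Int_compact) auto
  moreover have "z \<in> ?A" using neg assms by auto
  ultimately obtain y where y: "y \<in> ?A" "\<And>y'. y' \<in> ?A \<Longrightarrow> y \<le> y'"
    using compact_attains_inf[of ?A] by blast
  have "y \<noteq> 0" using y(1) by auto
  then have "y > 0" using y(1) by auto
  have "0 \<le> (1 + Gamma (1 - \<alpha>) * y) * E (- y) - 1"
  proof (rule has_bochner_integral_mono[OF has_bochner_integral_zero marchaud_identity])
    show "0 \<le> indicator {0<..<1} r * ((E (- (y * r powr (\<alpha> + \<gamma>))) - E (- y)) * kernel r)" for r
    proof -
      have "E (- y) \<le> E (- (y * r powr (\<alpha> + \<gamma>)))" if "r \<in> {0<..<1}"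
      proof -
        have "y * r powr (\<alpha> + \<gamma>) \<notin> ?A"
          using y(2)[of "y * r powr (\<alpha> + \<gamma>)"] scaled_arg[OF \<open>y > 0\<close> that] by linarith
        then show ?thesis
          using y(1) scaled_arg[OF \<open>y > 0\<close> that] by auto
      qed
      then show "0 \<le> indicator {0<..<1} r * ((E (- (y * r powr (\<alpha> + \<gamma>))) - E (- y)) * kernel r)"
        using \<alpha> by (auto simp: indicator_def)
    qed
  qed (use \<open>y > 0\<close> in auto)
  moreover have "(1 + Gamma (1 - \<alpha>) * y) * E (- y) \<le> 0"
    using y(1) \<open>y > 0\<close> \<alpha> Gamma_real_pos[of "1 - \<alpha>"] by (intro mult_nonneg_nonpos) auto
  ultimately show False by simp
qed

text \<open>\<open>c\<close> is chosen so that \<open>\<Gamma>(1-\<alpha>) / c - 1\<close> is the Marchaud integral of \<open>1 - r^(\<alpha>+\<gamma>)\<close>; this makes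
  \<open>2 / (1 + c z)\<close> a supersolution.\<close>

lemma E_upper:
  assumes "0 \<le> z"
  defines "c \<equiv> Gamma (1 + \<gamma>) / Gamma (1 + \<alpha> + \<gamma>)"
  shows "E (- z) < 2 / (1 + c * z)"
proof (rule ccontr)
  assume large: "\<not> E (- z) < 2 / (1 + c * z)"
  have c: "c > 0" unfolding c_def using \<alpha> \<gamma> by (intro divide_pos_pos Gamma_real_pos) auto
  define G where "G = Gamma (1 - \<alpha>)"
  have G: "G > 0" unfolding G_def using \<alpha> by (intro Gamma_real_pos) auto
  let ?w = "\<lambda>y. 2 / (1 + c * y)"
  let ?A = "{y. 2 \<le> (1 + c * y) * E (- y)} \<inter> {0..z}"
  \<comment> \<open>The contact condition is multiplied out by the denominator, so that both sides
    are continuous on the whole line.\<close>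
  have "closed {y. 2 \<le> (1 + c * y) * E (- y)}"
    by (intro closed_Collect_le continuous_intros continuous_on_compose2[OF continuous_on_E]) auto
  then have "compact ?A"
    by (intro closed_Int_compact) auto
  moreover have "z \<in> ?A" using large assms(1) c by (simp add: field_simps add_pos_nonneg)
  ultimately obtain y where y: "y \<in> ?A" "\<And>y'. y' \<in> ?A \<Longrightarrow> y \<le> y'"
    using compact_attains_inf[of ?A] by blast
  \<comment> \<open>At 0 the barrier has the value 2, strictly above E(0) = 1.\<close>
  have "y \<noteq> 0" using y(1) by auto
  then have "y > 0" using y(1) by auto
  have wy: "?w y \<le> E (- y)"
    using y(1) \<open>y > 0\<close> c by (simp add: field_simps add_pos_nonneg)
  have "(1 + G * y) * E (- y) - 1 \<le> 2 * c * y / (1 + c * y) * (G / c - 1)"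
  proof (rule has_bochner_integral_mono[OF marchaud_identity[folded G_def]])
    have "Gamma (1 - \<alpha>) * Gamma (1 + (\<alpha> + \<gamma>)) / Gamma (1 + (\<alpha> + \<gamma>) - \<alpha>) = G / c"
      by (simp add: G_def c_def add_ac)
    then show "has_bochner_integral lborel
        (\<lambda>r. 2 * c * y / (1 + c * y) * (indicator {0<..<1} r * ((1 - r powr (\<alpha> + \<gamma>)) * kernel r)))
        (2 * c * y / (1 + c * y) * (G / c - 1))"
      using marchaud_power_integral[of \<alpha> "\<alpha> + \<gamma>"] \<alpha> \<gamma>
      by (intro has_bochner_integral_mult_right) auto
    show "indicator {0<..<1} r * ((E (- (y * r powr (\<alpha> + \<gamma>))) - E (- y)) * kernel r)
        \<le> 2 * c * y / (1 + c * y) * (indicator {0<..<1} r * ((1 - r powr (\<alpha> + \<gamma>)) * kernel r))" for r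
    proof (cases "r \<in> {0<..<1}")
      case True
      let ?\<rho> = "r powr (\<alpha> + \<gamma>)"
      have \<rho>: "0 \<le> y * ?\<rho>" "y * ?\<rho> < y" "0 \<le> ?\<rho>" "?\<rho> \<le> 1"
        using scaled_arg[OF \<open>y > 0\<close> True] True \<alpha> \<gamma> by (auto intro!: powr_le1)
      have D: "1 \<le> 1 + c * (y * ?\<rho>)"
        using \<rho> c by simp
      have "y * ?\<rho> \<notin> ?A"
        using y(2)[of "y * ?\<rho>"] \<rho> by linarith
      then have "(1 + c * (y * ?\<rho>)) * E (- (y * ?\<rho>)) < 2"
        using y(1) \<rho> by (auto simp: not_le)
      then have "E (- (y * ?\<rho>)) < ?w (y * ?\<rho>)"
        using D by (simp add: pos_less_divide_eq mult.commute)
      \<comment> \<open>Before the contact point E lies below the barrier, at y it lies on or above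
        it; so increments of E are bounded by those of the barrier.\<close>
      then have "E (- (y * ?\<rho>)) - E (- y) \<le> ?w (y * ?\<rho>) - ?w y"
        using wy by simp
      also have "\<dots> = 2 * c * y * (1 - ?\<rho>) / (1 + c * y) / (1 + c * (y * ?\<rho>))"
      proof -
        have "2 / u - 2 / v = 2 * c * y * (1 - ?\<rho>) / v / u"
          if "u \<noteq> 0" "v \<noteq> 0" "v - u = c * y * (1 - ?\<rho>)" for u v
        proof -
          have "2 / u - 2 / v = 2 * (v - u) / v / u"
            using that(1,2) by (simp add: field_simps)
          then show ?thesis
            by (simp only: that(3) mult.assoc)
        qed
        moreover have "1 + c * (y * ?\<rho>) \<noteq> 0" "1 + c * y \<noteq> 0"
          using D mult_pos_pos[OF c \<open>y > 0\<close>] by linarith+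
        moreover have "(1 + c * y) - (1 + c * (y * ?\<rho>)) = c * y * (1 - ?\<rho>)"
          by (simp add: algebra_simps)
        ultimately show ?thesis
          by blast
      qed
      \<comment> \<open>Discarding the denominator, which is at least 1, leaves a multiple of 1 -
        r^(\<alpha>+\<gamma>), whose Marchaud integral is known to be G / c - 1.\<close>
      also have "\<dots> \<le> 2 * c * y * (1 - ?\<rho>) / (1 + c * y)"
      proof -
        have "0 < 1 + c * (y * ?\<rho>)" using D by linarith
        moreover have "0 \<le> 2 * c * y * (1 - ?\<rho>) / (1 + c * y)" using \<rho> c \<open>y > 0\<close> by simp
        ultimately show ?thesis
          using divide_left_mono[OF D, of "2 * c * y * (1 - ?\<rho>) / (1 + c * y)"] by simp
      qed
      finally have "(E (- (y * ?\<rho>)) - E (- y)) * kernel r \<le> 2 * c * y * (1 - ?\<rho>) / (1 + c * y) * kernel r"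
        using \<alpha> by (intro mult_right_mono) auto
      then show ?thesis
        using True by simp
    qed simp
  qed (use \<open>y > 0\<close> in auto)
  moreover have "(1 + G * y) * ?w y \<le> (1 + G * y) * E (- y)"
    using wy G \<open>y > 0\<close> by (intro mult_left_mono) auto
  ultimately have "(1 + G * y) * ?w y - 1 \<le> 2 * c * y / (1 + c * y) * (G / c - 1)"
    by simp
  then have "2 * (1 + G * y) - (1 + c * y) \<le> 2 * y * (G - c)"
  proof -
    assume le: "(1 + G * y) * ?w y - 1 \<le> 2 * c * y / (1 + c * y) * (G / c - 1)"
    have pos: "1 + c * y > 0" using mult_pos_pos[OF c \<open>y > 0\<close>] by linarith
    have "2 * c * y / (1 + c * y) * (G / c - 1) = 2 * y * (G - c) / (1 + c * y)"
    proof -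
      have "2 * c * y * (G / c - 1) = 2 * y * (G - c)" using c by (simp add: field_simps)
      then show ?thesis by simp
    qed
    moreover have "(1 + G * y) * ?w y - 1 = (2 * (1 + G * y) - (1 + c * y)) / (1 + c * y)"
      using pos by (simp add: divide_simps mult.commute)
    ultimately have "(2 * (1 + G * y) - (1 + c * y)) / (1 + c * y) \<le> 2 * y * (G - c) / (1 + c * y)"
      using le by (simp only:)
    then show ?thesis
      using pos by (simp only: divide_le_cancel)
  qed
  \<comment> \<open>The terms in G cancel and the inequality reduces to 1 + c y \<le> 0.\<close>
  moreover have "c * y > 0" using c \<open>y > 0\<close> by simp
  ultimately show False by (simp add: algebra_simps)
qed

end

section \<open>Pointwise growth of orthonormal polynomials\<close>

definition sine_poly :: "nat \<Rightarrow> (real \<Rightarrow> real) \<Rightarrow> bool" where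
  "sine_poly N f \<longleftrightarrow> (\<exists>b. \<forall>t. f t = (\<Sum>k=1..N. b k * sin (real k * t)))"

lemma sine_poly_0: "sine_poly N (\<lambda>t. 0)"
  unfolding sine_poly_def by (rule exI[of _ "\<lambda>_. 0"]) simp

lemma sine_poly_sin: "k \<le> N \<Longrightarrow> sine_poly N (\<lambda>t. sin (real k * t))"
proof (cases "k = 0")
  case False
  assume "k \<le> N"
  then show ?thesis
    unfolding sine_poly_def using False
    by (intro exI[of _ "\<lambda>j. if j = k then 1 else 0"]) (auto simp: if_distrib if_distribR cong: if_cong)
qed (simp add: sine_poly_0)

lemma sine_poly_add: "sine_poly N f \<Longrightarrow> sine_poly N g \<Longrightarrow> sine_poly N (\<lambda>t. f t + g t)"
  unfolding sine_poly_def
  by (elim exE, rule_tac x = "\<lambda>k. b k + ba k" in exI) (simp add: algebra_simps sum.distrib)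

lemma sine_poly_cmult: "sine_poly N f \<Longrightarrow> sine_poly N (\<lambda>t. c * f t)"
  unfolding sine_poly_def
  by (elim exE, rule_tac x = "\<lambda>k. c * b k" in exI) (simp add: sum_distrib_left mult.assoc)

lemma sine_poly_sum: "(\<And>i. i \<in> A \<Longrightarrow> sine_poly N (f i)) \<Longrightarrow> sine_poly N (\<lambda>t. \<Sum>i\<in>A. f i t)"
  by (induction A rule: infinite_finite_induct) (auto intro: sine_poly_0 sine_poly_add)

text \<open>Product-to-sum formula: multiplication by cos t splits frequency k into k - 1 and k +
  1.\<close>

lemma sine_poly_cos_mult:
  assumes "sine_poly N f"
  shows "sine_poly (Suc N) (\<lambda>t. cos t * f t)"
proof -
  obtain b where b: "f t = (\<Sum>k=1..N. b k * sin (real k * t))" for t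
    using assms unfolding sine_poly_def by blast
  have "cos t * f t = (\<Sum>k=1..N. b k / 2 * (sin (real (k - 1) * t) + sin (real (Suc k) * t)))" for t
    unfolding b sum_distrib_left
  proof (rule sum.cong[OF refl])
    fix k assume "k \<in> {1..N}"
    then have "real (k - 1) * t = real k * t - t" "real (Suc k) * t = real k * t + t"
      by (simp_all add: of_nat_diff algebra_simps)
    then show "cos t * (b k * sin (real k * t)) = b k / 2 * (sin (real (k - 1) * t) + sin (real (Suc k) * t))"
      by (simp only: sin_add sin_diff) (simp add: algebra_simps)
  qed
  moreover have "sine_poly (Suc N) (\<lambda>t. \<Sum>k=1..N. b k / 2 * (sin (real (k - 1) * t) + sin (real (Suc k) * t)))"
    by (intro sine_poly_sum sine_poly_cmult sine_poly_add sine_poly_sin) auto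
  ultimately show ?thesis by simp
qed

lemma sine_poly_mono:
  assumes "sine_poly N f" "N \<le> N'"
  shows "sine_poly N' f"
proof -
  obtain b where b: "f t = (\<Sum>k=1..N. b k * sin (real k * t))" for t
    using assms unfolding sine_poly_def by blast
  have "sine_poly N' (\<lambda>t. \<Sum>k=1..N. b k * sin (real k * t))"
    using assms(2) by (intro sine_poly_sum sine_poly_cmult sine_poly_sin) auto
  moreover have "(\<lambda>t. \<Sum>k=1..N. b k * sin (real k * t)) = f" using b by auto
  ultimately show ?thesis by simp
qed

text \<open>Induction along the Horner form. The factor sin t supplies frequency 1, and each further
  degree costs one multiplication by cos t.\<close>

lemma sine_poly_poly_cos:
  "sine_poly (Suc (degree p)) (\<lambda>t. poly p (x + d * cos t) * sin t)"
proof (induction p)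
  case 0
  then show ?case by (simp add: sine_poly_0)
next
  case (pCons a p)
  let ?f = "\<lambda>t. poly p (x + d * cos t) * sin t"
  let ?N = "Suc (degree (pCons a p))"
  have sin: "sine_poly ?N (\<lambda>t. a * sin t)"
    using sine_poly_cmult[OF sine_poly_sin[of 1 ?N]] by simp
  show ?case
  \<comment> \<open>For p = 0 the degree does not increase, so the frequency bound from the
    induction hypothesis would be too large; but then only a sin t remains.\<close>
  proof (cases "p = 0")
    case True
    then show ?thesis using sin by simp
  next
    case False
    then have "sine_poly ?N (\<lambda>t. a * sin t + (x * ?f t + d * (cos t * ?f t)))"
      using pCons.IH by (intro sine_poly_add sin sine_poly_cmult)
        (auto intro: sine_poly_mono sine_poly_cos_mult)
    moreover have "a * sin t + (x * ?f t + d * (cos t * ?f t)) =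
        poly (pCons a p) (x + d * cos t) * sin t" for t
      by (simp add: algebra_simps)
    ultimately show ?thesis by simp
  qed
qed

section \<open>Orthogonality of sines and the resulting pointwise bound for polynomials\<close>

lemma has_integral_cos_mult_pi:
  "((\<lambda>t. cos (real_of_int m * t)) has_integral (if m = 0 then pi else 0)) {0..pi}"
proof (cases "m = 0")
  case True
  then show ?thesis using has_integral_const_real[of "1::real" 0 pi] by simp
next
  case False
  have "((\<lambda>t. cos (real_of_int m * t)) has_integral
      (sin (real_of_int m * pi) / real_of_int m - sin (real_of_int m * 0) / real_of_int m)) {0..pi}"
    using False
    by (intro fundamental_theorem_of_calculus)
       (auto intro!: derivative_eq_intros simp flip: has_real_derivative_iff_has_vector_derivative)
  then show ?thesis
    using False by (simp add: sin_npi_int mult.commute)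
qed

lemma has_integral_sin_mult_sin:
  assumes "j \<ge> 1" "k \<ge> 1"
  shows "((\<lambda>t. sin (real j * t) * sin (real k * t)) has_integral (if j = k then pi / 2 else 0)) {0..pi}"
proof -
  have "((\<lambda>t. (cos (real_of_int (int j - int k) * t) - cos (real_of_int (int j + int k) * t)) / 2)
      has_integral ((if int j - int k = 0 then pi else 0) - (if int j + int k = 0 then pi else 0)) / 2) {0..pi}"
    by (intro has_integral_divide has_integral_diff has_integral_cos_mult_pi)
  moreover have "(cos (real_of_int (int j - int k) * t) - cos (real_of_int (int j + int k) * t)) / 2 =
      sin (real j * t) * sin (real k * t)" for t
    unfolding sin_times_sin by (simp only: of_int_diff of_int_add of_int_of_nat_eq left_diff_distrib distrib_right)
  moreover have "((if int j - int k = 0 then pi else 0) - (if int j + int k = 0 then pi else 0)) / 2 =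
      (if j = k then pi / 2 else 0)"
    using assms by simp
  ultimately show ?thesis by simp
qed

lemma has_integral_sine_poly_square:
  "((\<lambda>t. (\<Sum>k=1..N. b k * sin (real k * t))\<^sup>2) has_integral (pi / 2 * (\<Sum>k=1..N. (b k)\<^sup>2))) {0..pi}"
proof -
  have "((\<lambda>t. \<Sum>j=1..N. \<Sum>k=1..N. (b j * b k) * (sin (real j * t) * sin (real k * t))) has_integral
      (\<Sum>j=1..N. \<Sum>k=1..N. (b j * b k) * (if j = k then pi / 2 else 0))) {0..pi}"
    by (intro has_integral_sum has_integral_mult_right has_integral_sin_mult_sin) auto
  moreover have "(\<Sum>j=1..N. \<Sum>k=1..N. (b j * b k) * (if j = k then pi / 2 else 0)) = pi / 2 * (\<Sum>k=1..N. (b k)\<^sup>2)"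
    unfolding sum_distrib_left
    by (intro sum.cong refl) (simp add: if_distrib power2_eq_square mult_ac cong: if_cong)
  moreover have "(\<Sum>j=1..N. \<Sum>k=1..N. (b j * b k) * (sin (real j * t) * sin (real k * t))) =
      (\<Sum>k=1..N. b k * sin (real k * t))\<^sup>2" for t
    by (simp add: power2_eq_square sum_product mult_ac)
  ultimately show ?thesis by (simp only:)
qed

text \<open>Substituting \<open>y = x - d cos t\<close> turns \<open>p(y) sin t\<close> into a sine polynomial of degree
  \<open>degree p + 1\<close>, whose value at \<open>pi/2\<close> is controlled by Parseval and Cauchy--Schwarz.\<close>

lemma poly_square_le_integral:
  fixes p :: "real poly"
  assumes "d > 0"
  shows "(poly p x)\<^sup>2 \<le> 2 * real (Suc (degree p)) / (pi * d) * integral {x - d..x + d} (\<lambda>y. (poly p y)\<^sup>2)"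
proof -
  let ?N = "Suc (degree p)" and ?I = "integral {x - d..x + d} (\<lambda>y. (poly p y)\<^sup>2)"
  \<comment> \<open>With -d the substitution increases from x - d to x + d on the half period, and t
    = pi/2 gives the value at x.\<close>
  obtain b where b: "poly p (x + (- d) * cos t) * sin t = (\<Sum>k=1..?N. b k * sin (real k * t))" for t
    using sine_poly_poly_cos[of p x "- d"] unfolding sine_poly_def by blast
  have "(poly p x)\<^sup>2 = (\<Sum>k=1..?N. b k * sin (real k * (pi / 2)))\<^sup>2"
    using b[of "pi / 2"] by simp
  also have "\<dots> \<le> (\<Sum>k=1..?N. (b k)\<^sup>2) * (\<Sum>k=1..?N. (sin (real k * (pi / 2)))\<^sup>2)"
    by (rule Cauchy_Schwarz_ineq_sum)
  also have "\<dots> \<le> (\<Sum>k=1..?N. (b k)\<^sup>2) * (\<Sum>k=1..?N. 1)"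
    by (intro mult_left_mono sum_mono sum_nonneg) (auto simp: abs_square_le_1)
  finally have le: "(poly p x)\<^sup>2 \<le> real ?N * (\<Sum>k=1..?N. (b k)\<^sup>2)"
    by (simp add: mult.commute)
  have "pi / 2 * (\<Sum>k=1..?N. (b k)\<^sup>2) \<le> 1 / d * ?I"
  proof (rule has_integral_le[OF has_integral_sine_poly_square])
    have "((\<lambda>t. (d * sin t) *\<^sub>R (poly p (x - d * cos t))\<^sup>2) has_integral
        integral {x - d * cos 0..x - d * cos pi} (\<lambda>y. (poly p y)\<^sup>2)) {0..pi}"
    proof (rule has_integral_substitution[where c = "x - d" and d = "x + d"])
      show "(\<lambda>t. x - d * cos t) ` {0..pi} \<subseteq> {x - d..x + d}"
      proof -
        have "\<bar>d * cos t\<bar> \<le> d" for t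
          using assms mult_left_mono[OF abs_cos_le_one, of d t] by (simp add: abs_mult)
        then show ?thesis by (force simp: abs_le_iff)
      qed
    qed (use assms in \<open>auto intro!: derivative_eq_intros continuous_intros\<close>)
    from has_integral_mult_right[OF this, of "1 / d"]
    show "((\<lambda>t. sin t * (poly p (x - d * cos t))\<^sup>2) has_integral 1 / d * ?I) {0..pi}"
      using assms by simp
    show "(\<Sum>k=1..?N. b k * sin (real k * t))\<^sup>2 \<le> sin t * (poly p (x - d * cos t))\<^sup>2" if "t \<in> {0..pi}" for t
    proof -
      \<comment> \<open>One of the two factors sin t is discarded; the other is the Jacobian of the
        substitution, up to the factor d.\<close>
      have "0 \<le> sin t" using that by (auto intro: sin_ge_zero)
      then have "(sin t)\<^sup>2 \<le> sin t" by (simp add: power2_eq_square mult_left_le)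
      then have "(sin t)\<^sup>2 * (poly p (x - d * cos t))\<^sup>2 \<le> sin t * (poly p (x - d * cos t))\<^sup>2"
        by (rule mult_right_mono) simp
      then show ?thesis
        unfolding b[symmetric] power_mult_distrib by (simp add: mult.commute)
    qed
  qed
  then have "(\<Sum>k=1..?N. (b k)\<^sup>2) \<le> 2 / (pi * d) * ?I"
    using assms by (simp add: field_simps)
  then have "real ?N * (\<Sum>k=1..?N. (b k)\<^sup>2) \<le> real ?N * (2 / (pi * d) * ?I)"
    by (rule mult_left_mono) simp
  also have "\<dots> = 2 * real ?N / (pi * d) * ?I" by simp
  finally show ?thesis by (rule order_trans[OF le])
qed

text \<open>Normalisation bounds the weighted integral of the square by 1; where the weight is at
  least c, the unweighted integral is at most 1/c, and \<open>poly_square_le_integral\<close>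
  applies.\<close>

lemma orthonormal_polys_square_le:
  assumes Q: "orthonormal_polys D w Q" and w: "\<And>y. y \<in> D \<Longrightarrow> 0 \<le> w y"
    and I: "{x - d..x + d} \<subseteq> D" "0 < d" "\<And>y. y \<in> {x - d..x + d} \<Longrightarrow> c \<le> w y" "0 < c"
  shows "(poly (Q n) x)\<^sup>2 \<le> 2 * real (Suc n) / (pi * d * c)"
proof -
  let ?p = "\<lambda>y. (poly (Q n) y)\<^sup>2"
  have deg: "degree (Q n) = n"
    and int: "set_integrable lborel D (\<lambda>y. poly (Q n) y * poly (Q n) y * w y)"
    and one: "(LINT y:D|lborel. poly (Q n) y * poly (Q n) y * w y) = 1"
    using Q by (simp_all add: orthonormal_polys_def)
  have intI: "set_integrable lborel {x - d..x + d} ?p"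
    by (intro borel_integrable_atLeastAtMost' continuous_intros)
  then have "c * integral {x - d..x + d} ?p = (LINT y:{x - d..x + d}|lborel. c * ?p y)"
    by (simp add: set_borel_integral_eq_integral)
  also have "\<dots> \<le> (LINT y:D|lborel. poly (Q n) y * poly (Q n) y * w y)"
    unfolding set_lebesgue_integral_def
  proof (rule integral_mono)
    show "integrable lborel (\<lambda>y. indicat_real {x - d..x + d} y *\<^sub>R (c * ?p y))"
      using set_integrable_mult_right[of c, OF intI] by (simp add: set_integrable_def)
    show "integrable lborel (\<lambda>y. indicat_real D y *\<^sub>R (poly (Q n) y * poly (Q n) y * w y))"
      using int by (simp add: set_integrable_def)
    show "indicat_real {x - d..x + d} y *\<^sub>R (c * ?p y) \<le>
        indicat_real D y *\<^sub>R (poly (Q n) y * poly (Q n) y * w y)" for y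
    proof (cases "y \<in> {x - d..x + d}")
      case True
      then have "c * ?p y \<le> w y * ?p y" using I(3) by (intro mult_right_mono) auto
      then show ?thesis
        using True I(1) by (auto simp: indicator_def power2_eq_square mult_ac)
    next
      case False
      then show ?thesis using w by (auto simp: indicator_def)
    qed
  qed
  finally have "integral {x - d..x + d} ?p \<le> 1 / c"
    using one I(4) by (simp add: field_simps)
  then have "2 * real (Suc n) / (pi * d) * integral {x - d..x + d} ?p \<le> 2 * real (Suc n) / (pi * d) * (1 / c)"
    using I(2) by (intro mult_left_mono) auto
  with poly_square_le_integral[OF I(2), of "Q n" x] show ?thesis
    unfolding deg by simp
qed

section \<open>Convergence of the density\<close>

lemma Beta_real_pos:
  fixes p q :: real
  assumes "p > 0" "q > 0"
  shows "Beta p q > 0"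
  using assms by (simp add: Beta_def Gamma_real_pos)

text \<open>The substitution t = (1 + x)/2 reduces the integral to Beta(b + 1, a + 1); its Jacobian
  and the factor 2^(a+b) account for the power of 2 in the weight.\<close>

lemma jacobi_weight_has_bochner_integral:
  assumes "a > 0" "b > 0"
  shows "has_bochner_integral lborel (\<lambda>x. indicator {-1<..<1} x * jacobi_weight a b x) 1"
proof (rule has_bochner_integral_lborel_has_integral)
  have B: "Beta (a + 1) (b + 1) > 0"
    using assms by (intro Beta_real_pos) auto
  let ?C = "Beta (a + 1) (b + 1) * 2 powr (a + b + 1)"
  have "((\<lambda>t. t powr (b + 1 - 1) * (1 - t) powr (a + 1 - 1)) has_integral Beta (b + 1) (a + 1)) (cbox 0 1)"
    using has_integral_Beta_real[of "b + 1" "a + 1"] assms by simp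
  from has_integral_affinity'[OF this, of "1 / 2" "1 / 2"]
  have "((\<lambda>x. (x / 2 + 1 / 2) powr b * (1 - (x / 2 + 1 / 2)) powr a) has_integral
      2 * Beta (a + 1) (b + 1)) {-1..1}"
    by (simp add: Beta_commute)
  then have "((\<lambda>x. 2 powr (a + b) / ?C * ((x / 2 + 1 / 2) powr b * (1 - (x / 2 + 1 / 2)) powr a)) has_integral
      2 powr (a + b) / ?C * (2 * Beta (a + 1) (b + 1))) {-1..1}"
    by (rule has_integral_mult_right)
  also have "2 powr (a + b) / ?C * (2 * Beta (a + 1) (b + 1)) = 1"
    using B by (simp add: powr_add)
  finally have *: "((\<lambda>x. 2 powr (a + b) / ?C * ((x / 2 + 1 / 2) powr b * (1 - (x / 2 + 1 / 2)) powr a))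
      has_integral 1) {-1<..<1}"
    by (simp add: has_integral_Icc_iff_Ioo)
  show "(jacobi_weight a b has_integral 1) {-1<..<1}"
  proof (rule has_integral_eq[OF _ *])
    fix x :: real assume x: "x \<in> {-1<..<1}"
    have "x / 2 + 1 / 2 = (1 + x) / 2" "1 - (x / 2 + 1 / 2) = (1 - x) / 2"
      by (simp_all add: field_simps)
    then have "2 powr (a + b) * ((x / 2 + 1 / 2) powr b * (1 - (x / 2 + 1 / 2)) powr a) =
        (1 - x) powr a * (1 + x) powr b"
      using x by (simp only:) (simp add: powr_divide powr_add)
    then show "2 powr (a + b) / ?C * ((x / 2 + 1 / 2) powr b * (1 - (x / 2 + 1 / 2)) powr a) = jacobi_weight a b x"
      by (simp add: jacobi_weight_def)
  qed
  show "0 \<le> jacobi_weight a b x" for x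
    using B by (auto simp: jacobi_weight_def)
  show "set_borel_measurable borel {-1<..<1} (jacobi_weight a b)"
    unfolding set_borel_measurable_def jacobi_weight_def by measurable
qed

lemma jacobi_weight_pos:
  assumes "a > 0" "b > 0" "-1 < x" "x < 1"
  shows "jacobi_weight a b x > 0"
  using assms by (auto simp: jacobi_weight_def intro!: mult_pos_pos divide_pos_pos Beta_real_pos)

text \<open>Tonelli: the integrals of the absolute terms are at most K times a summable sequence.
  The almost everywhere convergence is stated separately because it also identifies the integrand
  with the kernel series.\<close>

lemma suminf_integral_bounded:
  fixes h :: "nat \<Rightarrow> 'a \<Rightarrow> real" and e :: "nat \<Rightarrow> real"
  assumes int: "\<And>n. integrable M (h n)" and bound: "\<And>n. (\<integral>y. \<bar>h n y\<bar> \<partial>M) \<le> K"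
    and e: "summable (\<lambda>n. \<bar>e n\<bar>)"
  shows "AE y in M. summable (\<lambda>n. \<bar>e n * h n y\<bar>)"
    and "(\<integral>y. (\<Sum>n. e n * h n y) \<partial>M) = (\<Sum>n. e n * (\<integral>y. h n y \<partial>M))"
proof -
  have [measurable]: "h n \<in> borel_measurable M" for n
    using int by (rule borel_measurable_integrable)
  have int': "integrable M (\<lambda>y. e n * h n y)" for n
    using int by simp
  have norm_eq: "(\<integral>y. \<bar>e n * h n y\<bar> \<partial>M) = \<bar>e n\<bar> * (\<integral>y. \<bar>h n y\<bar> \<partial>M)" for n
    by (simp add: abs_mult)
  have summ: "summable (\<lambda>n. \<integral>y. \<bar>e n * h n y\<bar> \<partial>M)"
  proof (rule summable_comparison_test)
    show "\<exists>N. \<forall>n\<ge>N. norm (\<integral>y. \<bar>e n * h n y\<bar> \<partial>M) \<le> \<bar>e n\<bar> * K"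
      using bound by (auto simp: norm_eq abs_mult intro!: mult_left_mono)
    show "summable (\<lambda>n. \<bar>e n\<bar> * K)" using e by (rule summable_mult2)
  qed
  have "(\<integral>\<^sup>+y. (\<Sum>n. ennreal \<bar>e n * h n y\<bar>) \<partial>M) = (\<Sum>n. \<integral>\<^sup>+y. ennreal \<bar>e n * h n y\<bar> \<partial>M)"
    by (rule nn_integral_suminf) measurable
  also have "\<dots> = (\<Sum>n. ennreal (\<integral>y. \<bar>e n * h n y\<bar> \<partial>M))"
    using int' by (subst nn_integral_eq_integral) auto
  also have "\<dots> \<noteq> \<infinity>"
    using summ by (subst suminf_ennreal2) auto
  finally have "AE y in M. (\<Sum>n. ennreal \<bar>e n * h n y\<bar>) \<noteq> \<infinity>"
    by (intro nn_integral_PInf_AE) auto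
  then show AE: "AE y in M. summable (\<lambda>n. \<bar>e n * h n y\<bar>)"
    by eventually_elim (intro summable_suminf_not_top, auto)
  show "(\<integral>y. (\<Sum>n. e n * h n y) \<partial>M) = (\<Sum>n. e n * (\<integral>y. h n y \<partial>M))"
    using integral_suminf[OF int'] AE summ by simp
qed

lemma has_density_on_has_bochner_integral:
  assumes "prob_space M" "has_density_on M Y D f"
  shows "has_bochner_integral lborel (\<lambda>y. indicator D y * f y) 1"
proof (rule has_bochner_integral_nn_integral)
  interpret prob_space M by fact
  have nonneg: "0 \<le> f y" if "y \<in> D" for y
    using assms(2) that by (simp add: has_density_on_def)
  have dist: "distributed M lborel Y (\<lambda>y. ennreal (indicat_real D y * f y))"
    using assms(2) by (simp add: has_density_on_def)
  \<comment> \<open>\<open>distributed\<close> gives measurability of the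
    \<open>ennreal\<close>-valued density only; nonnegativity on D recovers the real function from
    it.\<close>
  have "(\<lambda>y. enn2real (ennreal (indicat_real D y * f y))) \<in> borel_measurable lborel"
    using distributed_borel_measurable[OF dist] by measurable
  also have "(\<lambda>y. enn2real (ennreal (indicat_real D y * f y))) = (\<lambda>y. indicat_real D y * f y)"
    using nonneg by (auto simp: indicator_def)
  finally show "(\<lambda>y. indicat_real D y * f y) \<in> borel_measurable lborel" .
  show "AE y in lborel. 0 \<le> indicat_real D y * f y" using nonneg by (auto simp: indicator_def)
  have "emeasure M (Y -` UNIV \<inter> space M) = (\<integral>\<^sup>+y. ennreal (indicat_real D y * f y) * indicator UNIV y \<partial>lborel)"
    by (rule distributed_emeasure[OF dist]) simp
  then show "(\<integral>\<^sup>+y. ennreal (indicat_real D y * f y) \<partial>lborel) = ennreal 1"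
    by (simp add: emeasure_space_1)
qed simp

text \<open>By the arithmetic-geometric mean inequality, 2 |f q| \<le> (q^2 + (f/w)^2) w on D for
  the polynomial q. The first part integrates to 1 by normalisation, so the bound does not depend on
  n.\<close>

lemma Fourier_integrand_bound:
  assumes Q: "orthonormal_polys D w Q" and w: "\<And>y. y \<in> D \<Longrightarrow> 0 < w y"
    and f: "(\<lambda>y. indicator D y * f y) \<in> borel_measurable lborel"
    and L2: "set_integrable lborel D (\<lambda>y. (f y / w y)\<^sup>2 * w y)"
  shows "integrable lborel (\<lambda>y. indicator D y * (f y * poly (Q n) y))"
    and "(\<integral>y. \<bar>indicator D y * (f y * poly (Q n) y)\<bar> \<partial>lborel)
      \<le> (1 + (LINT y:D|lborel. (f y / w y)\<^sup>2 * w y)) / 2"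
proof -
  let ?q = "poly (Q n)"
  let ?h = "\<lambda>y. indicat_real D y * (f y * ?q y)"
  let ?g = "\<lambda>y. (indicat_real D y *\<^sub>R (?q y * ?q y * w y) + indicat_real D y *\<^sub>R ((f y / w y)\<^sup>2 * w y)) / 2"
  have int: "integrable lborel (\<lambda>y. indicat_real D y *\<^sub>R (?q y * ?q y * w y))"
    and one: "(\<integral>y. indicat_real D y *\<^sub>R (?q y * ?q y * w y) \<partial>lborel) = 1"
    using Q by (simp_all add: orthonormal_polys_def set_integrable_def set_lebesgue_integral_def)
  have int_g: "integrable lborel ?g"
    using int L2 unfolding set_integrable_def by (intro integrable_divide Bochner_Integration.integrable_add)
  have le: "\<bar>?h y\<bar> \<le> ?g y" for y
  proof (cases "y \<in> D")
    case True
    have "2 * \<bar>f y * ?q y\<bar> = 2 * (\<bar>?q y\<bar> * \<bar>f y / w y\<bar>) * w y"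
      using w[OF True] by (simp add: abs_mult)
    also have "\<dots> \<le> (\<bar>?q y\<bar>\<^sup>2 + \<bar>f y / w y\<bar>\<^sup>2) * w y"
      using w[OF True] sum_squares_bound[of "\<bar>?q y\<bar>" "\<bar>f y / w y\<bar>"]
      by (intro mult_right_mono) (auto simp: mult.assoc)
    finally show ?thesis
      using True by (simp add: algebra_simps power2_eq_square)
  qed simp
  have "continuous_on UNIV ?q" by (intro continuous_intros)
  then have "?q \<in> borel_measurable lborel" by (simp add: borel_measurable_continuous_onI)
  then have "(\<lambda>y. indicat_real D y * f y * ?q y) \<in> borel_measurable lborel"
    using f by measurable
  then have "?h \<in> borel_measurable lborel" by (simp add: mult.assoc)
  then show int_h: "integrable lborel ?h"
  proof (rule Bochner_Integration.integrable_bound[OF int_g], intro AE_I2)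
    show "norm (?h y) \<le> norm (?g y)" for y
      using le[of y] unfolding real_norm_def by (rule order_trans[OF _ abs_ge_self])
  qed
  have "(\<integral>y. \<bar>?h y\<bar> \<partial>lborel) \<le> (\<integral>y. ?g y \<partial>lborel)"
    using int_h int_g le by (intro integral_mono) auto
  also have "\<dots> = (1 + (LINT y:D|lborel. (f y / w y)\<^sup>2 * w y)) / 2"
    using int L2 one by (simp add: set_integrable_def set_lebesgue_integral_def)
  finally show "(\<integral>y. \<bar>?h y\<bar> \<partial>lborel) \<le> (1 + (LINT y:D|lborel. (f y / w y)\<^sup>2 * w y)) / 2" .
qed

text \<open>The closed interval around x with radius half the distance to the nearer endpoint stays
  inside (-1,1), and the weight has a positive minimum on it. The constant depends on x but not on
  n.\<close>

lemma jacobi_orthonormal_polys_bound: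
  assumes "orthonormal_polys {-1<..<1} (jacobi_weight a b) Q" "a > 0" "b > 0" "-1 < x" "x < 1"
  obtains C where "C > 0" "\<And>n. \<bar>poly (Q n) x\<bar> \<le> C * sqrt (real (Suc n))"
proof -
  define d where "d = min (1 - x) (1 + x) / 2"
  have d: "0 < d" "{x - d..x + d} \<subseteq> {-1<..<1}"
    using assms(4,5) by (auto simp: d_def min_def field_simps split: if_splits)
  have "continuous_on {x - d..x + d} (jacobi_weight a b)"
    unfolding jacobi_weight_def using d(2) Beta_real_pos[of "a + 1" "b + 1"] assms(2,3)
    by (intro continuous_intros) auto
  then obtain y where y: "y \<in> {x - d..x + d}" "\<And>z. z \<in> {x - d..x + d} \<Longrightarrow> jacobi_weight a b y \<le> jacobi_weight a b z"
    using continuous_attains_inf[of "{x - d..x + d}" "jacobi_weight a b"] d(1) by auto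
  define c where "c = jacobi_weight a b y"
  have c: "c > 0" unfolding c_def using y(1) d(2) assms(2,3) by (intro jacobi_weight_pos) auto
  define B where "B = 2 / (pi * d * c)"
  have B: "B > 0" using c d(1) by (simp add: B_def)
  have "\<bar>poly (Q n) x\<bar> \<le> sqrt B * sqrt (real (Suc n))" for n
  proof -
    have "(poly (Q n) x)\<^sup>2 \<le> 2 * real (Suc n) / (pi * d * c)"
      by (rule orthonormal_polys_square_le[OF assms(1) _ d(2,1) _ c])
        (use y(2) jacobi_weight_pos[OF assms(2,3)] in \<open>auto simp: c_def intro: less_imp_le\<close>)
    also have "\<dots> = B * real (Suc n)" by (simp add: B_def)
    finally show ?thesis
      by (metis real_sqrt_abs real_sqrt_le_iff real_sqrt_mult)
  qed
  then show thesis using that[of "sqrt B"] B by simp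
qed

theorem theorem6p6:
  fixes M :: "'w measure"
    and X S :: "real \<Rightarrow> 'w \<Rightarrow> real"
    and Q :: "nat \<Rightarrow> real poly"
    and f :: "real \<Rightarrow> real"
    and \<alpha> \<gamma> \<theta> a b x :: real
  assumes "0 < \<alpha>" "\<alpha> < 1" "0 \<le> \<gamma>" "0 < \<alpha> + \<gamma>" "\<alpha> + \<gamma> \<le> 1"
    and "\<theta> > 0" "a > 0" "b > 0"
    and "orthonormal_polys {-1<..<1} (jacobi_weight a b) Q"
    and "stretched_jacobi_setting M \<alpha> \<gamma> \<theta> a b Q S X"
    and "has_density_on M (stretched_process \<alpha> \<gamma> S X 0) {-1<..<1} f"
    and "set_integrable lborel {-1<..<1}
           (\<lambda>y. (f y / jacobi_weight a b y)\<^sup>2 * jacobi_weight a b y)"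
    and "\<And>c d. -1 < c \<Longrightarrow> c \<le> d \<Longrightarrow> d < 1 \<Longrightarrow>
           uniform_limit {c..d} (\<lambda>N y. \<Sum>n<N. fourier_coeff Q f n * poly (Q n) y)
             (\<lambda>y. f y / jacobi_weight a b y) sequentially"
    and "-1 < x" "x < 1"
  shows "((\<lambda>t. stretched_density \<alpha> \<gamma> \<theta> a b Q f t x) \<longlongrightarrow>
           (1 - x) powr a * (1 + x) powr b / (Beta (a + 1) (b + 1) * 2 powr (a + b + 1))) at_top"
proof -
  interpret KS: kilbas_saigo_exponents \<alpha> \<gamma>
    using assms(1-3) by unfold_locales
  let ?D = "{-1<..<1::real}"
  define m where "m = jacobi_weight a b"
  define lam where "lam = jacobi_eigenvalue \<theta> a b"
  define h where "h n y = indicator ?D y * (f y * poly (Q n) y)" for n y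
  define K where "K = (1 + (LINT y:?D|lborel. (f y / m y)\<^sup>2 * m y)) / 2"
  have m_pos: "0 < m y" if "y \<in> ?D" for y
    using that assms(7,8) jacobi_weight_pos by (auto simp: m_def)
  have mx: "0 < m x" using m_pos assms(14,15) by auto
  have "prob_space M" using assms(10) by (simp add: stretched_jacobi_setting_def)
  then have f: "has_bochner_integral lborel (\<lambda>y. indicator ?D y * f y) 1"
    using assms(11) by (rule has_density_on_has_bochner_integral)
  then have f_meas [measurable]: "(\<lambda>y. indicator ?D y * f y) \<in> borel_measurable lborel"
    by (auto simp: has_bochner_integral_iff)
  have h_int: "integrable lborel (h n)" and h_bound: "(\<integral>y. \<bar>h n y\<bar> \<partial>lborel) \<le> K" for n
    using Fourier_integrand_bound[OF assms(9)[folded m_def] m_pos f_meas assms(12)[folded m_def]]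
    by (simp_all add: h_def[abs_def] K_def)
  have K: "0 \<le> K" using h_bound[of 0] by (rule order_trans[rotated]) simp

  \<comment> \<open>Summable bound for the coefficients at x\<close>
  obtain C where C: "C > 0" "\<And>n. \<bar>poly (Q n) x\<bar> \<le> C * sqrt (real (Suc n))"
    using jacobi_orthonormal_polys_bound[OF assms(9,7,8,14,15)] by blast
  define c where "c = Gamma (1 + \<gamma>) / Gamma (1 + \<alpha> + \<gamma>)"
  have c: "c > 0"
    unfolding c_def using assms(1-3) by (intro divide_pos_pos Gamma_real_pos) auto
  define \<kappa> where "\<kappa> = \<theta> / (a + b + 2)"
  have \<kappa>: "\<kappa> > 0" using assms(6-8) by (simp add: \<kappa>_def)
  have lam_ge: "\<kappa> * real n ^ 2 \<le> lam n" for n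
  proof -
    have "lam n = \<kappa> * (real n * (real n + a + b + 1))" by (simp add: lam_def jacobi_eigenvalue_def \<kappa>_def)
    moreover have "real n ^ 2 \<le> real n * (real n + a + b + 1)"
      using assms(7,8) unfolding power2_eq_square by (intro mult_left_mono) auto
    ultimately show ?thesis using \<kappa> by simp
  qed
  define e where "e T n = KS.E (- (lam n * T)) * poly (Q n) x" for T n
  \<comment> \<open>Eigenvalue growth contributes n^(-2) and the polynomial bound n^(1/2), together
    the summable order n^(-3/2). The shift by one leaves out n = 0, where the eigenvalue vanishes
    and nothing decays.\<close>
  define R where "R n = real (Suc n) powr (-2) * sqrt (real (Suc (Suc n)))" for n
  have "summable R"
  proof (rule summable_comparison_test_bigo)
    show "summable (\<lambda>n. norm (real n powr (- (3 / 2))))"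
      by (simp add: summable_real_powr_iff)
    show "R \<in> O(\<lambda>n. real n powr (- (3 / 2)))"
      unfolding R_def by real_asymp
  qed
  have e_bound: "\<bar>e T (Suc n)\<bar> \<le> 2 * C / (c * \<kappa> * T) * R n" if "T > 0" for T n
  proof -
    let ?n = "real (Suc n)"
    have pos: "0 < c * (\<kappa> * ?n ^ 2 * T)" using c \<kappa> that by simp
    have z: "\<kappa> * ?n ^ 2 * T \<le> lam (Suc n) * T" using lam_ge[of "Suc n"] that by (intro mult_right_mono) auto
    have "0 \<le> \<kappa> * ?n ^ 2 * T" using \<kappa> that by simp
    with z have "0 \<le> lam (Suc n) * T" by linarith
    then have "\<bar>KS.E (- (lam (Suc n) * T))\<bar> \<le> 2 / (1 + c * (lam (Suc n) * T))"
      using KS.E_pos KS.E_upper unfolding c_def by (simp add: less_imp_le)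
    also have "\<dots> \<le> 2 / (c * (\<kappa> * ?n ^ 2 * T))"
    proof (rule divide_left_mono)
      have "c * (\<kappa> * ?n ^ 2 * T) \<le> c * (lam (Suc n) * T)" using z c by (intro mult_left_mono) auto
      then show "c * (\<kappa> * ?n ^ 2 * T) \<le> 1 + c * (lam (Suc n) * T)" by linarith
      with pos show "0 < (1 + c * (lam (Suc n) * T)) * (c * (\<kappa> * ?n ^ 2 * T))"
        by (metis less_le_trans mult_pos_pos)
    qed simp
    finally have "\<bar>e T (Suc n)\<bar> \<le> 2 / (c * (\<kappa> * ?n ^ 2 * T)) * (C * sqrt (real (Suc (Suc n))))"
      unfolding e_def abs_mult using C(2)[of "Suc n"] pos by (intro mult_mono) auto
    also have "\<dots> = 2 * C / (c * \<kappa> * T) * (1 / ?n ^ 2 * sqrt (real (Suc (Suc n))))"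
      by (simp add: mult_ac)
    also have "1 / ?n ^ 2 = ?n powr (-2)"
      by (simp only: powr_minus_divide powr_numeral of_nat_0_le_iff)
    finally show ?thesis unfolding R_def .
  qed
  have e_summable: "summable (\<lambda>n. \<bar>e T n\<bar>)" if "T > 0" for T
  proof -
    have "summable (\<lambda>n. \<bar>e T (Suc n)\<bar>)"
    proof (rule summable_comparison_test')
      show "summable (\<lambda>n. 2 * C / (c * \<kappa> * T) * R n)" using \<open>summable R\<close> by (rule summable_mult)
      show "norm \<bar>e T (Suc n)\<bar> \<le> 2 * C / (c * \<kappa> * T) * R n" if "n \<ge> 0" for n
        using e_bound[OF \<open>T > 0\<close>, of n] by (simp only: real_norm_def abs_idempotent)
    qed
    then show ?thesis by (rule summable_Suc_iff[THEN iffD1])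
  qed

  \<comment> \<open>Series representation of the density\<close>
  have density_eq: "stretched_density \<alpha> \<gamma> \<theta> a b Q f t x = m x * (\<Sum>n. e (t powr (\<alpha> + \<gamma>)) n * integral\<^sup>L lborel (h n))"
    if "t > 0" for t
  proof -
    define T where "T = t powr (\<alpha> + \<gamma>)"
    have T: "T > 0" using that by (simp add: T_def)
    note exch = suminf_integral_bounded[where h = h and e = "e T", OF h_int h_bound e_summable[OF T]]
    have kernel_eq: "stretched_transition_density \<alpha> \<gamma> \<theta> a b Q x t y = m x * (\<Sum>n. e T n * poly (Q n) y)" for y
      by (simp add: stretched_transition_density_def KS.kilbas_saigo_eq m_def e_def lam_def T_def)
    have [measurable]: "poly (Q n) \<in> borel_measurable borel" for n
      by (intro borel_measurable_continuous_onI continuous_intros)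
    have "stretched_density \<alpha> \<gamma> \<theta> a b Q f t x =
        (\<integral>y. m x * (\<Sum>n. e T n * poly (Q n) y) * (indicator ?D y * f y) \<partial>lborel)"
      by (simp add: stretched_density_def set_lebesgue_integral_def kernel_eq mult_ac)
    also have "\<dots> = (\<integral>y. m x * (\<Sum>n. e T n * h n y) \<partial>lborel)"
    proof (rule integral_cong_AE)
      show "AE y in lborel. m x * (\<Sum>n. e T n * poly (Q n) y) * (indicator ?D y * f y) = m x * (\<Sum>n. e T n * h n y)"
      proof (rule AE_mp[OF exch(1)], intro AE_I2 impI)
        fix y assume elim: "summable (\<lambda>n. \<bar>e T n * h n y\<bar>)"
        let ?u = "indicator ?D y * f y"
        have h_eq: "e T n * h n y = (e T n * poly (Q n) y) * ?u" for n by (simp add: h_def)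
        show "m x * (\<Sum>n. e T n * poly (Q n) y) * ?u = m x * (\<Sum>n. e T n * h n y)"
        \<comment> \<open>Where the cut-off f vanishes, both sides are 0 whether or not the kernel
          series converges; elsewhere its convergence follows from that of the product by dividing
          by \<open>?u\<close>.\<close>
        proof (cases "?u = 0")
          case True
          then show ?thesis unfolding h_eq by (simp only: mult_zero_right suminf_zero)
        next
          case False
          have "summable (\<lambda>n. (e T n * poly (Q n) y) * ?u)"
            using summable_rabs_cancel[OF elim] unfolding h_eq .
          from summable_mult2[OF this, of "inverse ?u"]
          have "summable (\<lambda>n. e T n * poly (Q n) y)"
            by (simp only: mult.assoc[of "e T _ * poly (Q _) y"] right_inverse[OF False] mult_1_right)
          from suminf_mult2[OF this, of ?u] show ?thesis
            unfolding h_eq by (simp only: mult.assoc[of "m x"])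
        qed
      qed
      have "h n \<in> borel_measurable lborel" for n using h_int by (rule borel_measurable_integrable)
      then show "(\<lambda>y. m x * (\<Sum>n. e T n * h n y)) \<in> borel_measurable lborel" by measurable
    qed measurable
    also have "\<dots> = m x * (\<Sum>n. e T n * integral\<^sup>L lborel (h n))"
      by (simp add: exch(2))
    finally show ?thesis by (simp add: T_def)
  qed

  \<comment> \<open>\<open>Q 0\<close> is a constant q with q^2 = 1, as the weight has mass 1; the
    integral of \<open>h 0\<close> is q, as f has mass 1; and E(0) = 1 since the eigenvalue at n = 0
    is 0. The sign of q cancels.\<close>
  have first: "e T 0 * integral\<^sup>L lborel (h 0) = 1" for T
  proof -
    obtain q where q: "Q 0 = [:q:]"
      using assms(9) by (metis degree_eq_zeroE orthonormal_polys_def)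
    have "1 = (LINT y:?D|lborel. poly (Q 0) y * poly (Q 0) y * jacobi_weight a b y)"
      using assms(9) by (simp add: orthonormal_polys_def)
    also have "\<dots> = (\<integral>y. (q * q) * (indicator ?D y * jacobi_weight a b y) \<partial>lborel)"
      by (simp add: q set_lebesgue_integral_def mult_ac)
    also have "\<dots> = q * q"
      using jacobi_weight_has_bochner_integral[OF assms(7,8)] by (simp add: has_bochner_integral_iff)
    finally have "q * q = 1" by simp
    moreover have "h 0 = (\<lambda>y. q * (indicator ?D y * f y))"
      by (rule ext) (simp add: h_def q)
    then have "integral\<^sup>L lborel (h 0) = q"
      using f by (simp add: has_bochner_integral_iff)
    ultimately show ?thesis
      by (simp add: e_def lam_def jacobi_eigenvalue_def q)
  qed

  have h_le: "\<bar>integral\<^sup>L lborel (h n)\<bar> \<le> K" for n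
    using integral_abs_bound[of lborel "h n"] h_bound[of n] by linarith
  \<comment> \<open>Splitting off the leading term leaves a remainder of order 1/T with T =
    t^(\<alpha>+\<gamma>), which gives an explicit rate of convergence.\<close>
  have dist: "norm (stretched_density \<alpha> \<gamma> \<theta> a b Q f t x - m x)
      \<le> m x * (2 * C / (c * \<kappa>) * K * suminf R) * t powr - (\<alpha> + \<gamma>)" if "t > 0" for t
  proof -
    define T where "T = t powr (\<alpha> + \<gamma>)"
    have T: "T > 0" using that by (simp add: T_def)
    let ?s = "\<lambda>n. e T n * integral\<^sup>L lborel (h n)"
    have le: "norm (?s (Suc n)) \<le> 2 * C / (c * \<kappa> * T) * K * R n" for n
    proof -
      have "norm (?s (Suc n)) \<le> (2 * C / (c * \<kappa> * T) * R n) * K"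
        unfolding real_norm_def abs_mult using e_bound[OF T, of n] h_le[of "Suc n"]
        by (intro mult_mono) auto
      then show ?thesis by (simp add: mult_ac)
    qed
    have summ: "summable (\<lambda>n. norm (?s (Suc n)))"
    proof (rule summable_comparison_test')
      show "summable (\<lambda>n. 2 * C / (c * \<kappa> * T) * K * R n)" using \<open>summable R\<close> by (rule summable_mult)
      show "norm (norm (?s (Suc n))) \<le> 2 * C / (c * \<kappa> * T) * K * R n" if "n \<ge> 0" for n
        using le[of n] by (simp only: real_norm_def abs_idempotent)
    qed
    then have "summable ?s"
      using summable_norm_cancel summable_Suc_iff by blast
    then have "suminf ?s = 1 + (\<Sum>n. ?s (Suc n))"
      using suminf_split_head[of ?s] first by simp
    then have "stretched_density \<alpha> \<gamma> \<theta> a b Q f t x - m x = m x * (\<Sum>n. ?s (Suc n))"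
      using density_eq[OF that] by (simp add: T_def algebra_simps)
    moreover have "norm (\<Sum>n. ?s (Suc n)) \<le> (\<Sum>n. 2 * C / (c * \<kappa> * T) * K * R n)"
      using summable_norm[OF summ] suminf_le[OF le summ summable_mult[OF \<open>summable R\<close>]]
      by (rule order_trans)
    ultimately have "norm (stretched_density \<alpha> \<gamma> \<theta> a b Q f t x - m x)
        \<le> m x * (2 * C / (c * \<kappa> * T) * K * suminf R)"
      using mx unfolding suminf_mult[OF \<open>summable R\<close>] by (simp only: real_norm_def abs_mult abs_of_pos mult_le_cancel_left_pos)
    also have "\<dots> = m x * (2 * C / (c * \<kappa>) * K * suminf R) * (1 / T)"
      by simp
    also have "1 / T = t powr - (\<alpha> + \<gamma>)"
      unfolding T_def by (rule powr_minus_divide[symmetric])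
    finally show ?thesis .
  qed
  have "((\<lambda>t. m x * (2 * C / (c * \<kappa>) * K * suminf R) * t powr - (\<alpha> + \<gamma>)) \<longlongrightarrow> 0) at_top"
    using assms(4) by (intro tendsto_mult_right_zero tendsto_neg_powr filterlim_ident) auto
  then have "((\<lambda>t. stretched_density \<alpha> \<gamma> \<theta> a b Q f t x - m x) \<longlongrightarrow> 0) at_top"
    by (rule Lim_null_comparison[rotated])
       (use dist in \<open>auto intro: eventually_mono[OF eventually_gt_at_top[of 0]]\<close>)
  then show ?thesis
    unfolding m_def jacobi_weight_def by (rule LIM_zero_cancel)
qed

end
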